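(* Let $X=\mathbf{Z}_2[T,T^{-1}]/\big((T^2+T+1)^2\big)$ be the Alexander quandle with operation $a*b=Ta+(1-T)b$. Then $H^2_{\rm Q}(X,\mathbf{Z}_2)\ne0$.
   Context: $\mathbf{Z}_2=\mathbf{Z}/2\mathbf{Z}$. A quandle is a set with a binary operation $*$ such that $a*a=a$; for all $a,b$ there is a unique $c$ with $a=c*b$; and $(a*b)*c=(a*c)*(b*c)$. Quandle cohomology: for $n\ge1$, $C_n^{\rm R}(X)$ is the free abelian group on $X^n$, $C_n^{\rm R}(X)=0$ for $n\le0$; for $n\ge2$ $$\partial_n(x_1,\dots,x_n)=\sum_{i=2}^n(-1)^i\big[(x_1,\dots,x_{i-1},x_{i+1},\dots,x_n)-(x_1*x_i,\dots,x_{i-1}*x_i,x_{i+1},\dots,x_n)\big],$$ and $\partial_n=0$ for $n\le1$. $C_n^{\rm D}(X)$ is the subgroup generated by tuples with $x_i=x_{i+1}$ for some $i$ (zero for $n\le1$), a subcomplex; $C_*^{\rm Q}(X)=C_*^{\rm R}(X)/C_*^{\rm D}(X)$; $H^n_{\rm Q}(X,G)=H^n(\mathrm{Hom}(C_*^{\rm Q}(X),G))$. *)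

theory Defs
  imports "HOL-Algebra.Free_Abelian_Groups" "HOL-Library.Z2" "HOL-Library.Poly_Mapping"
begin

locale quandle =
  fixes X :: "'a set" and op :: "'a \<Rightarrow> 'a \<Rightarrow> 'a"
  assumes closed: "\<lbrakk>a \<in> X; b \<in> X\<rbrakk> \<Longrightarrow> op a b \<in> X"
    and idem: "a \<in> X \<Longrightarrow> op a a = a"
    and right_invertible: "\<lbrakk>a \<in> X; b \<in> X\<rbrakk> \<Longrightarrow> \<exists>!c. c \<in> X \<and> a = op c b"
    and self_distrib:
      "\<lbrakk>a \<in> X; b \<in> X; c \<in> X\<rbrakk> \<Longrightarrow> op (op a b) c = op (op a c) (op b c)"

section \<open>Rack and quandle chain complexes\<close>

text \<open>
  Degrees are integers and an \<open>n\<close>-tuple is a list of length \<open>n\<close>. There are no tuples in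
  degrees \<open>n \<le> 0\<close> (the empty list is excluded), so the chain groups vanish there.
\<close>

definition tuples :: "'a set \<Rightarrow> int \<Rightarrow> 'a list set" where
  "tuples X n = {xs \<in> lists X. n \<ge> 1 \<and> int (length xs) = n}"

definition rack_chain_group :: "'a set \<Rightarrow> int \<Rightarrow> ('a list \<Rightarrow>\<^sub>0 int) monoid" where
  "rack_chain_group X n = free_Abelian_group (tuples X n)"

text \<open>
  The index \<open>i\<close> counts entries from 1, whereas list access counts from 0: the \<open>i\<close>-th entry of
  \<open>xs\<close> is \<open>xs ! (i - 1)\<close>. On tuples of length at most 1 the sum is empty.
\<close>

definition tuple_boundary :: "('a \<Rightarrow> 'a \<Rightarrow> 'a) \<Rightarrow> 'a list \<Rightarrow> ('a list \<Rightarrow>\<^sub>0 int)" where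
  "tuple_boundary op xs =
     (\<Sum>i = 2..length xs. frag_cmul ((-1) ^ i)
        (frag_of (take (i - 1) xs @ drop i xs)
         - frag_of (map (\<lambda>y. op y (xs ! (i - 1))) (take (i - 1) xs) @ drop i xs)))"

definition rack_boundary ::
  "('a \<Rightarrow> 'a \<Rightarrow> 'a) \<Rightarrow> ('a list \<Rightarrow>\<^sub>0 int) \<Rightarrow> ('a list \<Rightarrow>\<^sub>0 int)" where
  "rack_boundary op = frag_extend (tuple_boundary op)"

definition degenerate_chains :: "'a set \<Rightarrow> int \<Rightarrow> ('a list \<Rightarrow>\<^sub>0 int) set" where
  "degenerate_chains X n =
     generate (rack_chain_group X n)
       (frag_of ` {xs \<in> tuples X n. \<exists>i. Suc i < length xs \<and> xs ! i = xs ! Suc i})"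

definition quandle_chain_group :: "'a set \<Rightarrow> int \<Rightarrow> ('a list \<Rightarrow>\<^sub>0 int) set monoid" where
  "quandle_chain_group X n = rack_chain_group X n Mod degenerate_chains X n"

text \<open>
  The map induced by the rack boundary on the quotient: the cosets \<open>D + \<partial>c\<close>, for \<open>c\<close> in a given
  coset \<open>C\<close>, all coincide because the degenerate chains form a subcomplex. So their union is
  that common coset.
\<close>

definition quandle_boundary ::
  "'a set \<Rightarrow> ('a \<Rightarrow> 'a \<Rightarrow> 'a) \<Rightarrow> int \<Rightarrow> ('a list \<Rightarrow>\<^sub>0 int) set \<Rightarrow> ('a list \<Rightarrow>\<^sub>0 int) set" where
  "quandle_boundary X op n C =
     (\<Union>c\<in>C. degenerate_chains X (n - 1) #>\<^bsub>rack_chain_group X (n - 1)\<^esub> rack_boundary op c)"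

section \<open>Quandle cohomology\<close>

text \<open>
  The abelian group of homomorphisms. Elements of \<^const>\<open>hom\<close> are unconstrained outside the
  carrier of the source, so they are normalised there by extensionality.
\<close>

definition hom_group :: "('a, 'm) monoid_scheme \<Rightarrow> ('b, 'n) monoid_scheme \<Rightarrow> ('a \<Rightarrow> 'b) monoid" where
  "hom_group C G =
     \<lparr>carrier = hom C G \<inter> extensional (carrier C),
      monoid.mult = (\<lambda>f g. \<lambda>x\<in>carrier C. f x \<otimes>\<^bsub>G\<^esub> g x),
      one = (\<lambda>x\<in>carrier C. \<one>\<^bsub>G\<^esub>)\<rparr>"

definition quandle_cochain_group ::
  "'a set \<Rightarrow> int \<Rightarrow> ('b, 'm) monoid_scheme \<Rightarrow> (('a list \<Rightarrow>\<^sub>0 int) set \<Rightarrow> 'b) monoid" where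
  "quandle_cochain_group X n G = hom_group (quandle_chain_group X n) G"

definition quandle_coboundary ::
  "'a set \<Rightarrow> ('a \<Rightarrow> 'a \<Rightarrow> 'a) \<Rightarrow> int
    \<Rightarrow> (('a list \<Rightarrow>\<^sub>0 int) set \<Rightarrow> 'b) \<Rightarrow> (('a list \<Rightarrow>\<^sub>0 int) set \<Rightarrow> 'b)" where
  "quandle_coboundary X op n f =
     (\<lambda>C\<in>carrier (quandle_chain_group X (n + 1)). f (quandle_boundary X op (n + 1) C))"

definition quandle_cocycles ::
  "'a set \<Rightarrow> ('a \<Rightarrow> 'a \<Rightarrow> 'a) \<Rightarrow> int \<Rightarrow> ('b, 'm) monoid_scheme
    \<Rightarrow> (('a list \<Rightarrow>\<^sub>0 int) set \<Rightarrow> 'b) set" where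
  "quandle_cocycles X op n G =
     kernel (quandle_cochain_group X n G) (quandle_cochain_group X (n + 1) G)
       (quandle_coboundary X op n)"

definition quandle_coboundaries ::
  "'a set \<Rightarrow> ('a \<Rightarrow> 'a \<Rightarrow> 'a) \<Rightarrow> int \<Rightarrow> ('b, 'm) monoid_scheme
    \<Rightarrow> (('a list \<Rightarrow>\<^sub>0 int) set \<Rightarrow> 'b) set" where
  "quandle_coboundaries X op n G =
     quandle_coboundary X op (n - 1) ` carrier (quandle_cochain_group X (n - 1) G)"

definition quandle_cohomology_group ::
  "'a set \<Rightarrow> ('a \<Rightarrow> 'a \<Rightarrow> 'a) \<Rightarrow> int \<Rightarrow> ('b, 'm) monoid_scheme
    \<Rightarrow> (('a list \<Rightarrow>\<^sub>0 int) set \<Rightarrow> 'b) set monoid" where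
  "quandle_cohomology_group X op n G =
     subgroup_generated (quandle_cochain_group X n G) (quandle_cocycles X op n G)
       Mod quandle_coboundaries X op n G"

section \<open>The Alexander quandle \<open>\<int>\<^sub>2[T, T\<inverse>] / ((T\<^sup>2 + T + 1)\<^sup>2)\<close>\<close>

text \<open>
  Finitely supported functions \<open>int \<Rightarrow>\<^sub>0 bit\<close> with the convolution product form the group ring of
  the infinite cyclic group over the field \<^typ>\<open>bit\<close>, that is, the Laurent polynomials;
  \<open>Poly_Mapping.single k c\<close> is \<open>c T\<^sup>k\<close>.
\<close>

type_synonym laurent_Z2 = "int \<Rightarrow>\<^sub>0 bit"

definition laurent_T :: laurent_Z2 where
  "laurent_T = Poly_Mapping.single 1 1"

definition alexander_modulus :: laurent_Z2 where
  "alexander_modulus = (laurent_T ^ 2 + laurent_T + 1) ^ 2"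

text \<open>Congruence modulo the principal ideal generated by the modulus.\<close>

definition alexander_rel :: "laurent_Z2 \<Rightarrow> laurent_Z2 \<Rightarrow> bool" where
  "alexander_rel p q \<longleftrightarrow> alexander_modulus dvd p - q"

lemma equivp_alexander_rel: "equivp alexander_rel"
proof (rule equivpI)
  show "reflp alexander_rel"
    by (simp add: reflp_def alexander_rel_def)
  show "symp alexander_rel"
    unfolding symp_def alexander_rel_def by (metis dvd_minus_iff minus_diff_eq)
  show "transp alexander_rel"
    unfolding transp_def alexander_rel_def
    by (metis add_diff_eq diff_add_cancel dvd_add)
qed

quotient_type alexander_ring = laurent_Z2 / alexander_rel
  by (rule equivp_alexander_rel)

lemma lookup_single_times:
  "Poly_Mapping.lookup (Poly_Mapping.single j 1 * q) k = Poly_Mapping.lookup q (k - j)"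
  for q :: laurent_Z2
proof -
  have "Poly_Mapping.lookup (Poly_Mapping.single j 1 * q) k
      = (\<Sum>l. (\<Sum>i. Poly_Mapping.lookup q i when k = l + i) when l = j)"
    unfolding lookup_mult lookup_single
    by (rule Sum_any.cong) (simp only: when_def eq_commute[of j] if_distrib[of "\<lambda>x. x * _"] mult_1 mult_zero_left)
  also have "\<dots> = (\<Sum>i. Poly_Mapping.lookup q i when k = j + i)"
    by (rule Sum_any_when_equal)
  also have "\<dots> = (\<Sum>i. Poly_Mapping.lookup q i when i = k - j)"
    by (rule Sum_any.cong) (auto simp: when_def)
  finally show ?thesis
    by (simp only: Sum_any_when_equal)
qed

lemma laurent_T_power: "laurent_T ^ n = Poly_Mapping.single (int n) 1"
  by (induction n) (simp_all add: laurent_T_def mult_single single_one add.commute)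

lemma alexander_modulus_expand:
  "alexander_modulus = Poly_Mapping.single 4 1 + Poly_Mapping.single 2 1 + 1"
proof -
  have "x + x = 0" for x :: bit
    by (cases x) simp_all
  then have "(1 + 1 :: laurent_Z2) = 0"
    by (intro poly_mapping_eqI) (simp only: lookup_add lookup_zero)
  then have two: "(2 :: laurent_Z2) = 0"
    by (simp only: one_add_one)
  have "alexander_modulus = laurent_T ^ 4 + laurent_T ^ 2 + 1
      + 2 * (laurent_T ^ 3 + laurent_T ^ 2 + laurent_T)"
    unfolding alexander_modulus_def by algebra
  then show ?thesis
    unfolding two by (simp add: laurent_T_power)
qed

lemma alexander_modulus_not_unit: "\<not> alexander_modulus dvd 1"
proof
  assume "alexander_modulus dvd 1"
  then obtain q where q: "1 = alexander_modulus * q" ..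
  have "Poly_Mapping.lookup (alexander_modulus * q) k = Poly_Mapping.lookup q (k - 4)
      + Poly_Mapping.lookup q (k - 2) + Poly_Mapping.lookup q k" for k
    unfolding alexander_modulus_expand
    by (simp only: distrib_right lookup_add lookup_single_times mult_1)
  then have eq: "Poly_Mapping.lookup 1 k = Poly_Mapping.lookup q (k - 4)
      + Poly_Mapping.lookup q (k - 2) + Poly_Mapping.lookup q k" for k
    by (simp only: flip: q)
  have one: "Poly_Mapping.lookup (1 :: laurent_Z2) k = (if k = 0 then 1 else 0)" for k
    by (simp add: lookup_one when_def)
  let ?K = "Poly_Mapping.keys q"
  have "?K \<noteq> {}"
    using q by auto
  then have mem: "Max ?K \<in> ?K" "Min ?K \<in> ?K" and le: "Min ?K \<le> Max ?K"
    by (simp_all add: Min_le)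
  have above: "Poly_Mapping.lookup q k = 0" if "k > Max ?K" for k
    using that by (meson Max_ge finite_keys in_keys_iff leD)
  have below: "Poly_Mapping.lookup q k = 0" if "k < Min ?K" for k
    using that by (meson Min_le finite_keys in_keys_iff leD)
  have "Max ?K + 4 = 0"
    using eq[of "Max ?K + 4"] mem(1) above[of "2 + Max ?K"] above[of "Max ?K + 4"]
    by (auto simp: one in_keys_iff split: if_splits)
  moreover have "Min ?K = 0"
    using eq[of "Min ?K"] mem(2) below[of "Min ?K - 2"] below[of "Min ?K - 4"]
    by (auto simp: one in_keys_iff split: if_splits)
  ultimately show False
    using le by simp
qed

instantiation alexander_ring :: comm_ring_1
begin

lift_definition zero_alexander_ring :: alexander_ring is 0 .
lift_definition one_alexander_ring :: alexander_ring is 1 .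

lift_definition plus_alexander_ring :: "alexander_ring \<Rightarrow> alexander_ring \<Rightarrow> alexander_ring" is "(+)"
proof -
  fix p p' q q' :: laurent_Z2
  assume "alexander_rel p p'" "alexander_rel q q'"
  moreover have "p + q - (p' + q') = (p - p') + (q - q')"
    by simp
  ultimately show "alexander_rel (p + q) (p' + q')"
    unfolding alexander_rel_def by (metis dvd_add)
qed

lift_definition uminus_alexander_ring :: "alexander_ring \<Rightarrow> alexander_ring" is uminus
proof -
  fix p q :: laurent_Z2
  assume "alexander_rel p q"
  moreover have "- p - - q = - (p - q)"
    by simp
  ultimately show "alexander_rel (- p) (- q)"
    unfolding alexander_rel_def by (metis dvd_minus_iff)
qed

lift_definition minus_alexander_ring :: "alexander_ring \<Rightarrow> alexander_ring \<Rightarrow> alexander_ring" is "(-)"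
proof -
  fix p p' q q' :: laurent_Z2
  assume "alexander_rel p p'" "alexander_rel q q'"
  moreover have "p - q - (p' - q') = (p - p') - (q - q')"
    by simp
  ultimately show "alexander_rel (p - q) (p' - q')"
    unfolding alexander_rel_def by (metis dvd_diff)
qed

lift_definition times_alexander_ring :: "alexander_ring \<Rightarrow> alexander_ring \<Rightarrow> alexander_ring" is "(*)"
proof -
  fix p p' q q' :: laurent_Z2
  assume "alexander_rel p p'" "alexander_rel q q'"
  moreover have "p * q - p' * q' = (p - p') * q + p' * (q - q')"
    by (simp add: algebra_simps)
  ultimately show "alexander_rel (p * q) (p' * q')"
    unfolding alexander_rel_def by simp
qed

instance
proof
  fix a b c :: alexander_ring
  show "a * b * c = a * (b * c)"
    by transfer (simp add: alexander_rel_def mult.assoc)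
  show "a * b = b * a"
    by transfer (simp add: alexander_rel_def mult.commute)
  show "1 * a = a"
    by transfer (simp add: alexander_rel_def)
  show "a + b + c = a + (b + c)"
    by transfer (simp add: alexander_rel_def add.assoc)
  show "a + b = b + a"
    by transfer (simp add: alexander_rel_def add.commute)
  show "0 + a = a"
    by transfer (simp add: alexander_rel_def)
  show "- a + a = 0"
    by transfer (simp add: alexander_rel_def)
  show "a - b = a + - b"
    by transfer (simp add: alexander_rel_def)
  show "(a + b) * c = a * c + b * c"
    by transfer (simp add: alexander_rel_def distrib_right)
  show "(0 :: alexander_ring) \<noteq> 1"
    by transfer (simp add: alexander_rel_def alexander_modulus_not_unit)
qed

end

lift_definition alexander_T :: alexander_ring is laurent_T .

definition alexander_op :: "alexander_ring \<Rightarrow> alexander_ring \<Rightarrow> alexander_ring" where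
  "alexander_op a b = alexander_T * a + (1 - alexander_T) * b"

lift_definition alexander_T_inv :: alexander_ring is "Poly_Mapping.single (- 1) 1" .

lemma alexander_T_inv: "alexander_T_inv * alexander_T = 1"
  by transfer (simp add: alexander_rel_def laurent_T_def mult_single)

lemma quandle_alexander: "quandle UNIV alexander_op"
proof
  fix a b c :: alexander_ring
  let ?T = alexander_T and ?S = alexander_T_inv
  show "alexander_op a a = a"
    by (simp add: alexander_op_def algebra_simps)
  show "alexander_op (alexander_op a b) c = alexander_op (alexander_op a c) (alexander_op b c)"
    by (simp add: alexander_op_def algebra_simps)
  have inv: "?T * (?S * x) = x" "?S * (?T * x) = x" for x
    using alexander_T_inv by (metis mult.assoc mult.commute mult_1)+
  have "c = ?S * (a - (1 - ?T) * b)" if "a = alexander_op c b" for c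
    using that inv by (simp add: alexander_op_def)
  moreover have "a = alexander_op (?S * (a - (1 - ?T) * b)) b"
    using inv by (simp add: alexander_op_def)
  ultimately show "\<exists>!c. c \<in> UNIV \<and> a = alexander_op c b"
    by blast
qed simp

end

theory Submission
  imports Defs
begin

text \<open>
  Modulo \<open>T\<^sup>2 + T + 1\<close> the ring becomes the field with four elements, an extension of \<open>\<int>\<^sub>2\<close>
  of degree 2 on which multiplication by \<open>T\<close> preserves a bilinear form \<open>A\<close> with values in \<open>\<int>\<^sub>2\<close>
  and \<open>A(v, v) \<noteq> 0\<close> for \<open>v \<noteq> 0\<close>. Invariance makes \<open>\<phi>(x, y) = A((1 - T)(x - y), y)\<close> a quandle
  2-cocycle. Since \<open>0 * 1 = 1 - T\<close> and \<open>(1 - T) * (-T) = 0\<close>, the chain \<open>(0, 1) + (1 - T, -T)\<close> is a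
  cycle, on which every coboundary vanishes, whereas \<open>\<phi>\<close> takes the value \<open>A(1 - T, 1 - T) = 1\<close>.
\<close>

section \<open>Degenerate chains as a normal subgroup of the rack chains\<close>

lemma group_rack_chain_group: "group (rack_chain_group X n)"
  by (simp add: rack_chain_group_def)

lemma normal_degenerate_chains: "degenerate_chains X n \<lhd> rack_chain_group X n"
proof -
  interpret comm_group "rack_chain_group X n"
    by (simp add: rack_chain_group_def abelian_free_Abelian_group)
  have "subgroup (degenerate_chains X n) (rack_chain_group X n)"
    unfolding degenerate_chains_def
    by (rule generate_is_subgroup) (auto simp: rack_chain_group_def)
  then show ?thesis
    by (rule subgroup_imp_normal)
qed

lemma group_quandle_chain_group: "group (quandle_chain_group X n)"
  unfolding quandle_chain_group_def
  by (rule normal.factorgroup_is_group[OF normal_degenerate_chains])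

lemma carrier_quandle_chain_group:
  "carrier (quandle_chain_group X n)
     = (\<lambda>c. degenerate_chains X n #>\<^bsub>rack_chain_group X n\<^esub> c) ` carrier (rack_chain_group X n)"
  by (auto simp: quandle_chain_group_def FactGroup_def RCOSETS_def)

lemma zero_in_degenerate_chains: "0 \<in> degenerate_chains X n"
  using generate.one[of "rack_chain_group X n"]
  by (simp add: degenerate_chains_def rack_chain_group_def)

lemma degenerate_chains_add:
  "\<lbrakk>c \<in> degenerate_chains X n; d \<in> degenerate_chains X n\<rbrakk> \<Longrightarrow> c + d \<in> degenerate_chains X n"
  using generate.eng[of c "rack_chain_group X n" _ d]
  by (simp add: degenerate_chains_def rack_chain_group_def)

lemma degenerate_chains_minus:
  assumes "c \<in> degenerate_chains X n" shows "- c \<in> degenerate_chains X n"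
proof -
  interpret normal "degenerate_chains X n" "rack_chain_group X n"
    by (rule normal_degenerate_chains)
  \<comment> \<open>The group inverse of a chain is identified with \<open>- c\<close> once the
    support of \<open>c\<close> is known to lie in the generating set.\<close>
  have "Poly_Mapping.keys c \<subseteq> tuples X n"
    using mem_carrier[OF assms] by (simp add: rack_chain_group_def)
  with m_inv_closed[OF assms] show ?thesis
    by (simp add: rack_chain_group_def)
qed

lemma frag_of_degenerate:
  "\<lbrakk>xs \<in> tuples X n; Suc i < length xs; xs ! i = xs ! Suc i\<rbrakk>
    \<Longrightarrow> frag_of xs \<in> degenerate_chains X n"
  unfolding degenerate_chains_def by (rule generate.incl) blast

section \<open>The boundary induced on quandle chains\<close>

text \<open>Chains are built from single tuples by differences and the boundary is additive, so a
  check on tuples suffices.\<close>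

lemma rack_boundary_closed:
  assumes "\<And>xs. xs \<in> tuples X n \<Longrightarrow> tuple_boundary op xs \<in> carrier (rack_chain_group X (n - 1))"
    and "c \<in> carrier (rack_chain_group X n)"
  shows "rack_boundary op c \<in> carrier (rack_chain_group X (n - 1))"
proof -
  have "Poly_Mapping.keys c \<subseteq> tuples X n"
    using assms(2) by (simp add: rack_chain_group_def)
  then show ?thesis
  proof (induction c rule: free_Abelian_group_induct[consumes 1, case_names zero diff frag_of])
    case (diff x y)
    then show ?case
      using keys_diff[of "rack_boundary op x" "rack_boundary op y"]
      by (auto simp: rack_boundary_def frag_extend_diff rack_chain_group_def)
  qed (use assms(1) in \<open>simp_all add: rack_boundary_def rack_chain_group_def\<close>)
qed

lemma rack_boundary_degenerate:
  assumes bd: "\<And>xs i. \<lbrakk>xs \<in> tuples X n; Suc i < length xs; xs ! i = xs ! Suc i\<rbrakk>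
      \<Longrightarrow> tuple_boundary op xs \<in> degenerate_chains X (n - 1)"
    and "c \<in> degenerate_chains X n"
  shows "rack_boundary op c \<in> degenerate_chains X (n - 1)"
  using assms(2) unfolding degenerate_chains_def[of X n]
proof (induction rule: generate.induct)
  case one
  then show ?case
    by (simp add: rack_chain_group_def rack_boundary_def zero_in_degenerate_chains)
next
  case (incl h)
  then show ?case
    by (auto simp: rack_boundary_def intro: bd)
next
  case (inv h)
  then have "inv\<^bsub>rack_chain_group X n\<^esub> h = - h"
    by (auto simp: rack_chain_group_def)
  with inv show ?case
    by (auto simp: rack_boundary_def frag_extend_minus intro!: degenerate_chains_minus bd)
next
  case (eng c d)
  then show ?case
    by (simp add: rack_chain_group_def rack_boundary_def frag_extend_add degenerate_chains_add)
qed

text \<open>Changing the representative by a degenerate chain changes its boundary by a degenerate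
  chain, so all cosets in the union defining \<open>quandle_boundary\<close> agree. The two
  conditions on tuples are left as hypotheses, to be verified degree by degree.\<close>

lemma quandle_boundary_coset:
  assumes cl: "\<And>xs. xs \<in> tuples X n \<Longrightarrow> tuple_boundary op xs \<in> carrier (rack_chain_group X (n - 1))"
    and deg: "\<And>xs i. \<lbrakk>xs \<in> tuples X n; Suc i < length xs; xs ! i = xs ! Suc i\<rbrakk>
      \<Longrightarrow> tuple_boundary op xs \<in> degenerate_chains X (n - 1)"
    and c: "c \<in> carrier (rack_chain_group X n)"
  shows "quandle_boundary X op n (degenerate_chains X n #>\<^bsub>rack_chain_group X n\<^esub> c)
    = degenerate_chains X (n - 1) #>\<^bsub>rack_chain_group X (n - 1)\<^esub> rack_boundary op c"
proof -
  let ?D = "degenerate_chains X (n - 1)" and ?R = "rack_chain_group X (n - 1)"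
  interpret D: normal ?D ?R
    by (rule normal_degenerate_chains)
  have "?D #>\<^bsub>?R\<^esub> rack_boundary op (d + c) = ?D #>\<^bsub>?R\<^esub> rack_boundary op c"
    if "d \<in> degenerate_chains X n" for d
  proof -
    have "rack_boundary op (d + c) = rack_boundary op d \<otimes>\<^bsub>?R\<^esub> rack_boundary op c"
      by (simp add: rack_chain_group_def rack_boundary_def frag_extend_add)
    moreover have d: "rack_boundary op d \<in> ?D"
      using deg that by (rule rack_boundary_degenerate)
    moreover have "rack_boundary op c \<in> carrier ?R"
      using cl c by (rule rack_boundary_closed)
    ultimately have "?D #>\<^bsub>?R\<^esub> rack_boundary op (d + c)
        = (?D #>\<^bsub>?R\<^esub> rack_boundary op d) #>\<^bsub>?R\<^esub> rack_boundary op c"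
      using D.coset_mult_assoc[OF D.subset] by simp
    also have "?D #>\<^bsub>?R\<^esub> rack_boundary op d = ?D"
      using d by (simp add: D.coset_join2 D.is_subgroup)
    finally show ?thesis .
  qed
  moreover have "degenerate_chains X n #>\<^bsub>rack_chain_group X n\<^esub> c
      = (\<lambda>d. d + c) ` degenerate_chains X n"
    by (auto simp: r_coset_def rack_chain_group_def)
  \<comment> \<open>A union of equal cosets is that coset only over a nonempty index set.\<close>
  moreover have "degenerate_chains X n \<noteq> {}"
    using zero_in_degenerate_chains by blast
  ultimately show ?thesis
    by (simp add: quandle_boundary_def)
qed

section \<open>Tuples and boundaries in degrees 2 and 3\<close>

lemma tuples_2_iff: "xs \<in> tuples X 2 \<longleftrightarrow> (\<exists>x\<in>X. \<exists>y\<in>X. xs = [x, y])"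
proof -
  have "length xs = 2 \<longleftrightarrow> (\<exists>x y. xs = [x, y])"
    by (auto simp: numeral_eq_Suc length_Suc_conv)
  then show ?thesis
    by (auto simp: tuples_def in_lists_conv_set)
qed

lemma tuples_3_iff: "xs \<in> tuples X 3 \<longleftrightarrow> (\<exists>x\<in>X. \<exists>y\<in>X. \<exists>z\<in>X. xs = [x, y, z])"
proof -
  have "length xs = 3 \<longleftrightarrow> (\<exists>x y z. xs = [x, y, z])"
    by (auto simp: numeral_eq_Suc length_Suc_conv)
  then show ?thesis
    by (auto simp: tuples_def in_lists_conv_set)
qed

lemma tuple_boundary_2: "tuple_boundary op [x, y] = frag_of [x] - frag_of [op x y]"
  by (simp add: tuple_boundary_def numeral_2_eq_2)

lemma tuple_boundary_3:
  "tuple_boundary op [x, y, z]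
    = frag_of [x, z] - frag_of [op x y, z] - (frag_of [x, y] - frag_of [op x z, op y z])"
proof -
  have "{2..3} = {2, 3 :: nat}"
    by auto
  then show ?thesis
    by (simp add: tuple_boundary_def numeral_2_eq_2 numeral_3_eq_3)
qed

section \<open>A criterion for nonvanishing second cohomology\<close>

text \<open>In a trivial quotient the coset of \<open>f\<close> is the set of coboundaries itself.
  As the unit is a coboundary, \<open>f\<close> lies in its own coset and would be a
  coboundary.\<close>

lemma nontrivial_cohomologyI:
  assumes G: "group G"
    and f: "f \<in> quandle_cocycles X op n G" "f \<notin> quandle_coboundaries X op n G"
    and one: "\<one>\<^bsub>quandle_cochain_group X n G\<^esub> \<in> quandle_coboundaries X op n G"
  shows "carrier (quandle_cohomology_group X op n G) \<noteq> {\<one>\<^bsub>quandle_cohomology_group X op n G\<^esub>}"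
proof
  let ?C = "quandle_cochain_group X n G" and ?B = "quandle_coboundaries X op n G"
  let ?Z = "subgroup_generated ?C (quandle_cocycles X op n G)"
  assume triv: "carrier (quandle_cohomology_group X op n G) = {\<one>\<^bsub>quandle_cohomology_group X op n G\<^esub>}"
  have fC: "f \<in> carrier ?C"
    using f by (simp add: quandle_cocycles_def kernel_def)
  with f have "f \<in> carrier ?Z"
    by (simp add: carrier_subgroup_generated generate.incl)
  then have "?B #>\<^bsub>?Z\<^esub> f \<in> carrier (?Z Mod ?B)"
    by (auto simp: FactGroup_def RCOSETS_def)
  with triv have "?B #>\<^bsub>?Z\<^esub> f = ?B"
    by (simp add: quandle_cohomology_group_def)
  moreover have "\<one>\<^bsub>?C\<^esub> \<otimes>\<^bsub>?C\<^esub> f = f"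
  proof -
    interpret group G by (rule G)
    from fC show ?thesis
      by (auto simp: quandle_cochain_group_def hom_group_def hom_def Pi_def fun_eq_iff
          restrict_def extensional_def)
  qed
  ultimately have "f \<in> ?B"
    using one by (force simp: r_coset_def)
  with f show False
    by blast
qed

text \<open>The chain \<open>(x, y) + (x', y')\<close> is a cycle, so coboundaries vanish on it.\<close>

lemma quandle_cohomology_2_nontrivial:
  assumes Q: "quandle X op" and G: "comm_group G"
    and \<phi>: "\<And>x y. \<lbrakk>x \<in> X; y \<in> X\<rbrakk> \<Longrightarrow> \<phi> x y \<in> carrier G"
    and diagonal: "\<And>x. x \<in> X \<Longrightarrow> \<phi> x x = \<one>\<^bsub>G\<^esub>"
    and cocycle: "\<And>x y z. \<lbrakk>x \<in> X; y \<in> X; z \<in> X\<rbrakk>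
      \<Longrightarrow> \<phi> x z \<otimes>\<^bsub>G\<^esub> \<phi> (op x z) (op y z) = \<phi> (op x y) z \<otimes>\<^bsub>G\<^esub> \<phi> x y"
    and X: "x \<in> X" "y \<in> X" "x' \<in> X" "y' \<in> X"
    and cycle: "op x y = x'" "op x' y' = x"
    and ne: "\<phi> x y \<otimes>\<^bsub>G\<^esub> \<phi> x' y' \<noteq> \<one>\<^bsub>G\<^esub>"
  shows "carrier (quandle_cohomology_group X op 2 G) \<noteq> {\<one>\<^bsub>quandle_cohomology_group X op 2 G\<^esub>}"
proof -
  interpret quandle X op by (rule Q)
  interpret comm_group G by (rule G)
  let ?coset = "\<lambda>n c. degenerate_chains X n #>\<^bsub>rack_chain_group X n\<^esub> c"
  have t2: "[u, v] \<in> tuples X 2 \<longleftrightarrow> u \<in> X \<and> v \<in> X" for u v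
    by (simp add: tuples_2_iff)
  have t1: "[u] \<in> tuples X 1 \<longleftrightarrow> u \<in> X" for u
    by (simp add: tuples_def)
  have deg2: "frag_of [u, u] \<in> degenerate_chains X 2" if "u \<in> X" for u
    using frag_of_degenerate[of "[u, u]" X 2 0] that by (simp add: t2)
  have cl2: "tuple_boundary op xs \<in> carrier (rack_chain_group X 1)" if "xs \<in> tuples X 2" for xs
    using that closed
    by (auto simp: tuples_2_iff tuple_boundary_2 rack_chain_group_def t1
        dest!: subsetD[OF keys_diff])
  have bd2: "quandle_boundary X op 2 (?coset 2 c) = ?coset 1 (rack_boundary op c)"
    if c: "c \<in> carrier (rack_chain_group X 2)" for c
  proof -
    \<comment> \<open>By idempotence the boundary of \<open>[u, u]\<close> is
      \<open>[u] - [u]\<close>, hence zero.\<close>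
    have "tuple_boundary op xs \<in> degenerate_chains X 1"
      if "xs \<in> tuples X 2" "Suc i < length xs" "xs ! i = xs ! Suc i" for xs i
      using that zero_in_degenerate_chains
      by (auto simp: tuples_2_iff tuple_boundary_2 idem)
    then show ?thesis
      using quandle_boundary_coset[of X 2 op c] c cl2 by simp
  qed
  have cl3: "tuple_boundary op xs \<in> carrier (rack_chain_group X 2)" if "xs \<in> tuples X 3" for xs
    using that closed
    by (auto simp: tuples_3_iff tuple_boundary_3 rack_chain_group_def t2
        dest!: subsetD[OF keys_diff])
  have bd3: "quandle_boundary X op 3 (?coset 3 c) = ?coset 2 (rack_boundary op c)"
    if c: "c \<in> carrier (rack_chain_group X 3)" for c
  proof -
    have "tuple_boundary op xs \<in> degenerate_chains X 2"
      if xs: "xs \<in> tuples X 3" "Suc i < length xs" "xs ! i = xs ! Suc i" for xs i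
    proof -
      obtain u v w where uvw: "u \<in> X" "v \<in> X" "w \<in> X" "xs = [u, v, w]"
        using xs(1) by (auto simp: tuples_3_iff)
      with xs have "i = 0 \<and> u = v \<or> i = 1 \<and> v = w"
        by (auto simp: less_Suc_eq)
      then show ?thesis
      proof
        assume "i = 0 \<and> u = v"
        \<comment> \<open>Idempotence cancels the first two terms; the remaining two are both
          degenerate.\<close>
        then have "tuple_boundary op xs = - frag_of [u, u] + frag_of [op u w, op u w]"
          using uvw by (simp add: tuple_boundary_3 idem)
        then show ?thesis
          by (simp only: degenerate_chains_add degenerate_chains_minus deg2 closed uvw)
      next
        assume "i = 1 \<and> v = w"
        \<comment> \<open>Here the four terms cancel in pairs, the last one because
          \<open>op v v = v\<close>.\<close>
        then show ?thesis
          using uvw by (simp add: tuple_boundary_3 idem zero_in_degenerate_chains)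
      qed
    qed
    then show ?thesis
      using quandle_boundary_coset[of X 3 op c] c cl3 by simp
  qed
  \<comment> \<open>Pairs generate the rack 2-chains freely, so \<open>\<phi>\<close> extends to a
    homomorphism \<open>h\<close> on them.\<close>
  have "(\<lambda>xs. \<phi> (xs ! 0) (xs ! 1)) ` tuples X 2 \<subseteq> carrier G"
    by (auto simp: tuples_2_iff \<phi>)
  then obtain h where h: "h \<in> hom (rack_chain_group X 2) G"
    and h_frag: "\<And>u v. \<lbrakk>u \<in> X; v \<in> X\<rbrakk> \<Longrightarrow> h (frag_of [u, v]) = \<phi> u v"
    unfolding rack_chain_group_def using free_Abelian_group_universal t2
    by (metis (no_types, lifting) nth_Cons_0 nth_Cons_Suc One_nat_def)
  interpret h: group_hom "rack_chain_group X 2" G h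
    by (simp add: group_hom_def group_hom_axioms_def group_rack_chain_group h is_group)
  have h_add: "h (c + d) = h c \<otimes>\<^bsub>G\<^esub> h d"
    and h_diff: "h (c - d) = h c \<otimes>\<^bsub>G\<^esub> inv\<^bsub>G\<^esub> h d"
    if "c \<in> carrier (rack_chain_group X 2)" "d \<in> carrier (rack_chain_group X 2)" for c d
  proof -
    show "h (c + d) = h c \<otimes>\<^bsub>G\<^esub> h d"
      using h.hom_mult[OF that] by (simp add: rack_chain_group_def)
    have "c - d = c \<otimes>\<^bsub>rack_chain_group X 2\<^esub> inv\<^bsub>rack_chain_group X 2\<^esub> d"
      using that by (simp add: rack_chain_group_def)
    then show "h (c - d) = h c \<otimes>\<^bsub>G\<^esub> inv\<^bsub>G\<^esub> h d"
      using that by simp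
  qed
  have frag2: "frag_of [u, v] \<in> carrier (rack_chain_group X 2)" if "u \<in> X" "v \<in> X" for u v
    using that by (simp add: rack_chain_group_def t2)
  have diff2: "c - d \<in> carrier (rack_chain_group X 2)"
    if "c \<in> carrier (rack_chain_group X 2)" "d \<in> carrier (rack_chain_group X 2)" for c d
    using that keys_diff[of c d] by (auto simp: rack_chain_group_def)
  have h_bd: "h (rack_boundary op c) = \<one>\<^bsub>G\<^esub>" if "c \<in> carrier (rack_chain_group X 3)" for c
  proof -
    have "Poly_Mapping.keys c \<subseteq> tuples X 3"
      using that by (simp add: rack_chain_group_def)
    then show ?thesis
    proof (induction c rule: free_Abelian_group_induct[consumes 1, case_names zero diff frag_of])
      case zero
      then show ?case
        using h.hom_one by (simp add: rack_chain_group_def rack_boundary_def)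
    next
      case (diff c d)
      then show ?case
        using rack_boundary_closed[of X 3 op c] rack_boundary_closed[of X 3 op d] cl3
        by (simp add: rack_boundary_def frag_extend_diff h_diff rack_chain_group_def)
    next
      case (frag_of xs)
      then obtain u v w where uvw: "u \<in> X" "v \<in> X" "w \<in> X" "xs = [u, v, w]"
        by (auto simp: tuples_3_iff)
      have "h (rack_boundary op (frag_of xs)) = (\<phi> u w \<otimes>\<^bsub>G\<^esub> inv\<^bsub>G\<^esub> \<phi> (op u v) w)
          \<otimes>\<^bsub>G\<^esub> inv\<^bsub>G\<^esub> (\<phi> u v \<otimes>\<^bsub>G\<^esub> inv\<^bsub>G\<^esub> \<phi> (op u w) (op v w))"
        using uvw closed by (simp add: rack_boundary_def tuple_boundary_3 h_diff h_frag diff2 frag2)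
      \<comment> \<open>Regrouping by commutativity brings the two sides of the cocycle identity
        together.\<close>
      also have "\<dots> = (\<phi> u w \<otimes>\<^bsub>G\<^esub> \<phi> (op u w) (op v w))
          \<otimes>\<^bsub>G\<^esub> inv\<^bsub>G\<^esub> (\<phi> (op u v) w \<otimes>\<^bsub>G\<^esub> \<phi> u v)"
        using uvw closed by (simp add: \<phi> inv_mult m_ac)
      also have "\<dots> = \<one>\<^bsub>G\<^esub>"
        using uvw closed by (simp add: \<phi> cocycle)
      finally show ?case .
    qed
  qed
  \<comment> \<open>Since \<open>\<phi>\<close> is trivial on the diagonal, \<open>h\<close> kills
    the degenerate generators and factors through the quandle chains.\<close>
  have "degenerate_chains X 2 \<subseteq> kernel (rack_chain_group X 2) G h"
    unfolding degenerate_chains_def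
  proof (rule group.generate_subgroup_incl[OF group_rack_chain_group _ h.subgroup_kernel])
    show "frag_of ` {xs \<in> tuples X 2. \<exists>i. Suc i < length xs \<and> xs ! i = xs ! Suc i}
        \<subseteq> kernel (rack_chain_group X 2) G h"
      by (auto simp: tuples_2_iff kernel_def rack_chain_group_def h_frag diagonal)
  qed
  then obtain f0 where f0: "f0 \<in> hom (quandle_chain_group X 2) G"
    and f0_coset: "\<And>c. c \<in> carrier (rack_chain_group X 2) \<Longrightarrow> f0 (?coset 2 c) = h c"
    using h.FactGroup_universal_kernel[OF normal_degenerate_chains]
    unfolding quandle_chain_group_def by blast
  \<comment> \<open>Cochains are extensional, so the induced map is normalised outside the quotient
    group.\<close>
  define f where "f = restrict f0 (carrier (quandle_chain_group X 2))"
  have f_coset: "f (?coset 2 c) = h c" if "c \<in> carrier (rack_chain_group X 2)" for c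
    using that f0_coset by (simp add: f_def carrier_quandle_chain_group)
  have fC: "f \<in> carrier (quandle_cochain_group X 2 G)"
    using f0 group.is_monoid[OF group_quandle_chain_group[of X 2]]
    by (auto simp: f_def quandle_cochain_group_def hom_group_def hom_def monoid.m_closed)
  have "quandle_coboundary X op 2 f = \<one>\<^bsub>quandle_cochain_group X 3 G\<^esub>"
  proof -
    have "f (quandle_boundary X op 3 C) = \<one>\<^bsub>G\<^esub>" if "C \<in> carrier (quandle_chain_group X 3)" for C
    proof -
      from that obtain c where "c \<in> carrier (rack_chain_group X 3)" "C = ?coset 3 c"
        by (auto simp: carrier_quandle_chain_group)
      with rack_boundary_closed[of X 3 op c] cl3 show ?thesis
        by (simp add: bd3 f_coset h_bd)
    qed
    then show ?thesis
      by (auto simp: quandle_coboundary_def quandle_cochain_group_def hom_group_def)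
  qed
  with fC have cocycle_f: "f \<in> quandle_cocycles X op 2 G"
    by (simp add: quandle_cocycles_def kernel_def)
  define z where "z = frag_of [x, y] + frag_of [x', y']"
  have z: "z \<in> carrier (rack_chain_group X 2)"
    using X by (auto simp: z_def rack_chain_group_def t2 dest!: subsetD[OF keys_add])
  have zC: "?coset 2 z \<in> carrier (quandle_chain_group X 2)"
    using z by (simp add: carrier_quandle_chain_group)
  \<comment> \<open>The boundaries \<open>[x] - [x']\<close> and \<open>[x'] - [x]\<close>
    cancel.\<close>
  have bd_z: "rack_boundary op z = 0"
    by (simp add: z_def rack_boundary_def frag_extend_add tuple_boundary_2 cycle)
  have "f \<notin> quandle_coboundaries X op 2 G"
  proof
    assume "f \<in> quandle_coboundaries X op 2 G"
    then obtain g where g: "g \<in> hom (quandle_chain_group X 1) G"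
      and fg: "f = quandle_coboundary X op 1 g"
      by (auto simp: quandle_coboundaries_def quandle_cochain_group_def hom_group_def)
    \<comment> \<open>If \<open>f\<close> is the coboundary of \<open>g\<close>, its value on the
      class of \<open>z\<close> is \<open>g\<close> at the class of the boundary 0, which is the
      unit.\<close>
    have "?coset 1 0 = \<one>\<^bsub>quandle_chain_group X 1\<^esub>"
      by (auto simp: quandle_chain_group_def FactGroup_def r_coset_def rack_chain_group_def)
    then have "f (?coset 2 z) = \<one>\<^bsub>G\<^esub>"
      using zC bd2[OF z] bd_z hom_one[OF g group_quandle_chain_group is_group]
      by (simp add: fg quandle_coboundary_def)
    moreover have "f (?coset 2 z) = \<phi> x y \<otimes>\<^bsub>G\<^esub> \<phi> x' y'"
      using X z by (simp add: f_coset) (simp add: z_def h_add rack_chain_group_def h_frag t2)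
    ultimately show False
      using ne by simp
  qed
  moreover have "\<one>\<^bsub>quandle_cochain_group X 2 G\<^esub> \<in> quandle_coboundaries X op 2 G"
  proof -
    \<comment> \<open>The unit 1-cochain takes the value \<open>\<one>\<close> on the carrier only,
      so boundaries have to be placed there before its coboundary is seen to be the unit
      2-cochain.\<close>
    have "quandle_boundary X op 2 C \<in> carrier (quandle_chain_group X 1)"
      if "C \<in> carrier (quandle_chain_group X 2)" for C
    proof -
      from that obtain c where "c \<in> carrier (rack_chain_group X 2)" "C = ?coset 2 c"
        by (auto simp: carrier_quandle_chain_group)
      with rack_boundary_closed[of X 2 op c] cl2 show ?thesis
        by (simp add: bd2 carrier_quandle_chain_group)
    qed
    then have "\<one>\<^bsub>quandle_cochain_group X 2 G\<^esub>
        = quandle_coboundary X op 1 (\<one>\<^bsub>quandle_cochain_group X 1 G\<^esub>)"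
      by (auto simp: quandle_coboundary_def quandle_cochain_group_def hom_group_def)
    moreover have "\<one>\<^bsub>quandle_cochain_group X 1 G\<^esub> \<in> carrier (quandle_cochain_group X 1 G)"
      using group.is_monoid[OF group_quandle_chain_group[of X 1]]
      by (auto simp: quandle_cochain_group_def hom_group_def hom_def monoid.m_closed)
    ultimately show ?thesis
      by (auto simp: quandle_coboundaries_def)
  qed
  ultimately show ?thesis
    by (rule nontrivial_cohomologyI[OF is_group cocycle_f])
qed

section \<open>A functional on the Alexander ring from a periodic sequence\<close>

text \<open>A linear functional is encoded by its values \<open>c k\<close> on the powers
  \<open>T^k\<close>, so that vanishing on an ideal becomes a recurrence for
  \<open>c\<close>.\<close>

definition laurent_pairing :: "(int \<Rightarrow> bit) \<Rightarrow> laurent_Z2 \<Rightarrow> bit" where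
  "laurent_pairing c p = (\<Sum>k. Poly_Mapping.lookup p k * c k)"

lemma laurent_pairing_add: "laurent_pairing c (p + q) = laurent_pairing c p + laurent_pairing c q"
  unfolding laurent_pairing_def lookup_add distrib_right
  by (rule Sum_any.distrib; rule finite_mult_not_eq_zero_rightI; rule finite_lookup)

lemma laurent_pairing_add_left:
  "laurent_pairing (\<lambda>k. c k + d k) p = laurent_pairing c p + laurent_pairing d p"
  unfolding laurent_pairing_def distrib_left
  by (rule Sum_any.distrib; rule finite_mult_not_eq_zero_rightI; rule finite_lookup)

text \<open>Reindexing moves the factor \<open>T^j\<close> from the polynomial to a shift of the
  sequence.\<close>

lemma laurent_pairing_single_times:
  "laurent_pairing c (Poly_Mapping.single j 1 * p) = laurent_pairing (\<lambda>k. c (k + j)) p"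
  unfolding laurent_pairing_def lookup_single_times
  by (rule Sum_any.reindex_cong[of "\<lambda>k. k + j"]) (auto simp: fun_eq_iff intro: bij_betw_byWitness[of _ "\<lambda>k. k - j"])

text \<open>The Fibonacci numbers modulo 2, extended to all integers with period 3: the values 1, 1,
  0 start at index 0.\<close>

definition fibonacci_bit :: "int \<Rightarrow> bit" where
  "fibonacci_bit k = of_bool (k mod 3 \<noteq> 2)"

text \<open>Three consecutive indices meet each residue modulo 3 once, so exactly two of the three
  values are 1. The characteristic polynomial of this recurrence is
  \<open>T^2 + T + 1\<close>.\<close>

lemma fibonacci_bit_rec: "fibonacci_bit (k + 2) = fibonacci_bit (k + 1) + fibonacci_bit k"
proof -
  have "k mod 3 = 0 \<and> (k + 1) mod 3 = 1 \<and> (k + 2) mod 3 = 2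
      \<or> k mod 3 = 1 \<and> (k + 1) mod 3 = 2 \<and> (k + 2) mod 3 = 0
      \<or> k mod 3 = 2 \<and> (k + 1) mod 3 = 0 \<and> (k + 2) mod 3 = 1"
    by presburger
  then show ?thesis
    by (auto simp: fibonacci_bit_def)
qed

lemma bit_add_self: "b + b = (0 :: bit)"
  by (cases b) simp_all

lemma laurent_pairing_modulus:
  "laurent_pairing fibonacci_bit (alexander_modulus * p) = 0"
proof -
  \<comment> \<open>With \<open>a\<close>, \<open>b\<close> the values at \<open>k\<close> and
    \<open>k + 1\<close>, those at \<open>k + 2\<close>, \<open>k + 3\<close>, \<open>k + 4\<close>
    are \<open>a + b\<close>, \<open>a\<close>, \<open>b\<close>. The exponents 4, 2, 0 are those of
    the expanded modulus.\<close>
  have "fibonacci_bit (k + 4) + fibonacci_bit (k + 2) + fibonacci_bit k = 0" for k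
    using fibonacci_bit_rec[of "k + 2"] fibonacci_bit_rec[of "k + 1"] fibonacci_bit_rec[of k]
    by (cases "fibonacci_bit k"; cases "fibonacci_bit (k + 1)") (simp_all add: add.assoc)
  moreover have "laurent_pairing fibonacci_bit (alexander_modulus * p)
      = laurent_pairing (\<lambda>k. fibonacci_bit (k + 4) + fibonacci_bit (k + 2) + fibonacci_bit k) p"
    unfolding alexander_modulus_expand
    by (simp only: distrib_right laurent_pairing_add laurent_pairing_add_left
        laurent_pairing_single_times mult_1)
  ultimately show ?thesis
    by (simp add: laurent_pairing_def)
qed

text \<open>Well defined because the pairing kills all multiples of the modulus. The values at
  \<open>x\<close> and \<open>T x\<close> serve as the two coordinates of the image of
  \<open>x\<close> in the field with four elements.\<close>

lift_definition alexander_functional :: "alexander_ring \<Rightarrow> bit" is "laurent_pairing fibonacci_bit"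
proof -
  fix p q :: laurent_Z2
  assume "alexander_rel p q"
  then obtain r where r: "p - q = alexander_modulus * r"
    by (auto simp: alexander_rel_def)
  have "laurent_pairing fibonacci_bit p = laurent_pairing fibonacci_bit (p - q + q)"
    by simp
  also have "\<dots> = laurent_pairing fibonacci_bit q"
    by (simp only: laurent_pairing_add r laurent_pairing_modulus add_0)
  finally show "laurent_pairing fibonacci_bit p = laurent_pairing fibonacci_bit q" .
qed

lemma alexander_functional_add:
  "alexander_functional (x + y) = alexander_functional x + alexander_functional y"
  by transfer (rule laurent_pairing_add)

lemma alexander_functional_diff:
  "alexander_functional (x - y) = alexander_functional x + alexander_functional y"
proof -
  have "alexander_functional x = alexander_functional (x - y) + alexander_functional y"
    using alexander_functional_add[of "x - y" y] by (simp only: diff_add_cancel)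
  then have "alexander_functional x + alexander_functional y
      = alexander_functional (x - y) + (alexander_functional y + alexander_functional y)"
    by (simp only: add.assoc)
  then show ?thesis
    by (simp only: bit_add_self add_0_right)
qed

lemma alexander_functional_1: "alexander_functional 1 = 1"
proof (transfer, unfold laurent_pairing_def)
  have "(\<Sum>k. Poly_Mapping.lookup (1 :: laurent_Z2) k * fibonacci_bit k) = (\<Sum>k. fibonacci_bit k when k = 0)"
    by (rule Sum_any.cong) (simp only: lookup_one when_def if_distrib[of "\<lambda>x. x * _"] mult_1 mult_zero_left)
  then show "(\<Sum>k. Poly_Mapping.lookup (1 :: laurent_Z2) k * fibonacci_bit k) = 1"
    by (simp only: Sum_any_when_equal) (simp add: fibonacci_bit_def)
qed

text \<open>Two factors \<open>T\<close> shift the sequence by 2, where the Fibonacci recurrence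
  applies. This reduces every higher power of \<open>T\<close> to the two coordinates.\<close>

lemma alexander_functional_T:
  "alexander_functional (alexander_T * (alexander_T * x))
    = alexander_functional (alexander_T * x) + alexander_functional x"
  by transfer
    (simp only: laurent_T_def laurent_pairing_single_times add.assoc one_add_one
      fibonacci_bit_rec laurent_pairing_add_left)

section \<open>The invariant form and the resulting cocycle\<close>

text \<open>
  Here \<open>(p, q)\<close> and \<open>(r, s)\<close> are the coordinates of \<open>u\<close> and \<open>y\<close> in the field with four elements.
  Multiplication by \<open>T\<close> acts on coordinates by \<open>(p, q) \<mapsto> (q, p + q)\<close> and preserves
  \<open>A((p, q), (r, s)) = p r + p s + q s\<close>; the form below is \<open>A((1 - T) u, y)\<close>.
\<close>

definition alexander_form :: "alexander_ring \<Rightarrow> alexander_ring \<Rightarrow> bit" where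
  "alexander_form u y =
     (let p = alexander_functional u; q = alexander_functional (alexander_T * u);
          r = alexander_functional y; s = alexander_functional (alexander_T * y)
      in p * r + q * r + q * s)"

text \<open>The elements of \<open>integer_mod_group 2\<close> are the integers 0 and 1, so values
  of type \<open>bit\<close> have to be transported to them.\<close>

definition bit_to_int :: "bit \<Rightarrow> int" where
  "bit_to_int b = of_bool (b = 1)"

lemma bit_to_int_add: "(bit_to_int a + bit_to_int b) mod 2 = bit_to_int (a + b)"
  by (cases a; cases b) (simp_all add: bit_to_int_def)

theorem theorem8p6:
  shows "carrier (quandle_cohomology_group (UNIV :: alexander_ring set) alexander_op 2
                    (integer_mod_group 2))
         \<noteq> {\<one>\<^bsub>quandle_cohomology_group (UNIV :: alexander_ring set) alexander_op 2
                    (integer_mod_group 2)\<^esub>}"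
proof (rule quandle_cohomology_2_nontrivial[OF quandle_alexander abelian_integer_mod_group])
  let ?\<phi> = "\<lambda>x y. bit_to_int (alexander_form (x - y) y)"
  have zero: "alexander_functional 0 = 0"
    using alexander_functional_add[of 0 0] by simp
  have T_op: "alexander_T * alexander_op x y
      = alexander_T * (alexander_T * x) + (alexander_T * y - alexander_T * (alexander_T * y))" for x y
    by (simp add: alexander_op_def algebra_simps)
  have op: "alexander_op x y = alexander_T * x + (y - alexander_T * y)" for x y
    by (simp add: alexander_op_def algebra_simps)
  note expand = alexander_functional_add alexander_functional_diff alexander_functional_T
    right_diff_distrib
  show "?\<phi> x y \<in> carrier (integer_mod_group 2)" for x y
    by (simp add: bit_to_int_def carrier_integer_mod_group)
  show "?\<phi> x x = \<one>\<^bsub>integer_mod_group 2\<^esub>" for x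
    by (simp add: alexander_form_def zero bit_to_int_def)
  show "?\<phi> x z \<otimes>\<^bsub>integer_mod_group 2\<^esub> ?\<phi> (alexander_op x z) (alexander_op y z)
      = ?\<phi> (alexander_op x y) z \<otimes>\<^bsub>integer_mod_group 2\<^esub> ?\<phi> x y" for x y z
  proof -
    have "alexander_form (x - z) z + alexander_form (alexander_op x z - alexander_op y z) (alexander_op y z)
        = alexander_form (alexander_op x y - z) z + alexander_form (x - y) y"
      \<comment> \<open>\<open>T_op\<close> comes before \<open>op\<close>, while products of
        \<open>T\<close> with a quandle product are still visible as such.\<close>
      unfolding alexander_form_def Let_def expand T_op unfolding op expand
      \<comment> \<open>Both sides are now polynomials over \<open>bit\<close> in the six
        coordinates of \<open>x\<close>, \<open>y\<close>, \<open>z\<close>, compared at all 64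
        points.\<close>
      by (cases "alexander_functional x"; cases "alexander_functional (alexander_T * x)";
          cases "alexander_functional y"; cases "alexander_functional (alexander_T * y)";
          cases "alexander_functional z"; cases "alexander_functional (alexander_T * z)") simp_all
    then show ?thesis
      by (simp add: bit_to_int_add)
  qed
  show "alexander_op 0 1 = 1 - alexander_T" "alexander_op (1 - alexander_T) (- alexander_T) = 0"
    by (simp_all add: alexander_op_def algebra_simps)
  show "?\<phi> 0 1 \<otimes>\<^bsub>integer_mod_group 2\<^esub> ?\<phi> (1 - alexander_T) (- alexander_T)
      \<noteq> \<one>\<^bsub>integer_mod_group 2\<^esub>"
  proof -
    have "alexander_functional (- x) = alexander_functional x" for x
      using alexander_functional_diff[of 0 x] by (simp add: zero)
    \<comment> \<open>With \<open>t\<close> the value of the functional at \<open>T\<close>, the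
      summands are \<open>1 + t + t * t = 1\<close> and \<open>t + t + t * (t + 1) = 0\<close>, for
      either value of \<open>t\<close>.\<close>
    then have "alexander_form (0 - 1) 1 + alexander_form (1 - alexander_T - - alexander_T) (- alexander_T) = 1"
      using alexander_functional_T[of 1]
      by (cases "alexander_functional alexander_T")
        (simp_all add: alexander_form_def Let_def alexander_functional_1)
    then show ?thesis
      by (simp only: mult_integer_mod_group one_integer_mod_group of_nat_numeral bit_to_int_add)
        (simp add: bit_to_int_def)
  qed
qed simp_all

end
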